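(* Let $H(\mathbb{Z})$ be the discrete Heisenberg group with its standard generating set $\{a,b\}$. For every integer $r\ge 1$, each of the three sets $$\{g : \kappa_r^{\mathcal S}(g)>0\},\qquad \{g : \kappa_r^{\mathcal S}(g)=0\},\qquad \{g : \kappa_r^{\mathcal S}(g)<0\}$$ has positive density in $H(\mathbb{Z})$.
   Context: $H(\mathbb{Z})=\langle a,b : [a,b]\text{ is central}\rangle$. Let $|x|$ denote word length with respect to $\{a^{\pm1},b^{\pm1}\}$, $B_n=\{g: |g|\le n\}$ and $S_r=\{w : |w|=r\}$. For $g\ne e$, the spherical comparison curvature of radius $r$ is $$\kappa_r^{\mathcal S}(g)=\frac{|g|-\frac{1}{|S_r|}\sum_{w\in S_r}|w^{-1}gw|}{|g|}.$$ A subset $P\subseteq H(\mathbb{Z})$ has positive density if it occupies a positive proportion of large balls, i.e. $\liminf_{n\to\infty}|P\cap B_n|/|B_n|>0$. *)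

theory Defs
  imports Complex_Main "HOL-Algebra.Group" "HOL-Library.Extended_Real"
begin

datatype gen = GenA | GenB

text \<open>A letter is a generator with a sign: \<open>(x, True)\<close> stands for \<open>x\<close> and
  \<open>(x, False)\<close> for its formal inverse.\<close>

type_synonym word = "(gen \<times> bool) list"

definition inv_word :: "word \<Rightarrow> word" where
  "inv_word w = rev (map (\<lambda>(x, s). (x, \<not> s)) w)"

definition comm_ab :: word where
  "comm_ab = [(GenA, True), (GenB, True), (GenA, False), (GenB, False)]"

text \<open>The least congruence on words that makes letters with opposite signs cancel and
  makes the commutator of the two generators central.  The quotient is the group
  \<open>\<langle>a, b : [a, b] is central\<rangle>\<close>.\<close>

inductive heis_eq :: "word \<Rightarrow> word \<Rightarrow> bool" where
  refl: "heis_eq u u"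
| sym: "heis_eq u v \<Longrightarrow> heis_eq v u"
| trans: "heis_eq u v \<Longrightarrow> heis_eq v w \<Longrightarrow> heis_eq u w"
| append: "heis_eq u u' \<Longrightarrow> heis_eq v v' \<Longrightarrow> heis_eq (u @ v) (u' @ v')"
| cancel: "heis_eq [(x, s), (x, \<not> s)] []"
| central: "heis_eq (comm_ab @ w) (w @ comm_ab)"

quotient_type heis = word / heis_eq
  by (intro equivpI reflpI sympI transpI) (blast intro: heis_eq.refl heis_eq.sym heis_eq.trans)+

lift_definition heis_mult :: "heis \<Rightarrow> heis \<Rightarrow> heis" is "(@)"
  by (rule heis_eq.append)

lift_definition heis_one :: heis is "[]" .

lift_definition heis_a :: heis is "[(GenA, True)]" .

lift_definition heis_b :: heis is "[(GenB, True)]" .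

definition Heis :: "heis monoid" where
  "Heis = \<lparr>carrier = UNIV, mult = heis_mult, one = heis_one\<rparr>"

lemma heis_eq_inv_word_left: "heis_eq (inv_word w @ w) []"
proof (induction w)
  case Nil
  show ?case by (simp add: inv_word_def heis_eq.refl)
next
  case (Cons p w)
  obtain x s where p: "p = (x, s)" by (cases p)
  have "heis_eq ([(x, \<not> s), (x, s)] @ w) ([] @ w)"
    using heis_eq.append[OF heis_eq.cancel[of x "\<not> s"] heis_eq.refl] by simp
  then have "heis_eq (inv_word w @ ([(x, \<not> s), (x, s)] @ w)) (inv_word w @ w)"
    using heis_eq.append[OF heis_eq.refl] by simp
  then show ?case
    using heis_eq.trans[OF _ Cons.IH] by (simp add: p inv_word_def)
qed

lemma group_Heis: "group Heis"
proof (rule groupI)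
  fix x y z
  show "\<one>\<^bsub>Heis\<^esub> \<otimes>\<^bsub>Heis\<^esub> x = x"
    unfolding Heis_def by simp (transfer, simp add: heis_eq.refl)
  show "x \<otimes>\<^bsub>Heis\<^esub> y \<otimes>\<^bsub>Heis\<^esub> z = x \<otimes>\<^bsub>Heis\<^esub> (y \<otimes>\<^bsub>Heis\<^esub> z)"
    unfolding Heis_def by simp (transfer, simp add: heis_eq.refl)
  have "\<exists>y. heis_mult y x = heis_one"
    by transfer (blast intro: heis_eq_inv_word_left)
  then show "\<exists>y\<in>carrier Heis. y \<otimes>\<^bsub>Heis\<^esub> x = \<one>\<^bsub>Heis\<^esub>"
    by (simp add: Heis_def)
qed (simp_all add: Heis_def)

definition heis_gens :: "heis set" where
  "heis_gens = {heis_a, inv\<^bsub>Heis\<^esub> heis_a, heis_b, inv\<^bsub>Heis\<^esub> heis_b}"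

text \<open>In the following, \<open>S\<close> is a symmetric finite generating set of the group \<open>G\<close>
  (the inverses have to be listed in \<open>S\<close>).\<close>

definition word_length :: "('a, 'm) monoid_scheme \<Rightarrow> 'a set \<Rightarrow> 'a \<Rightarrow> nat" where
  "word_length G S g =
     (LEAST n. \<exists>xs. set xs \<subseteq> S \<and> length xs = n \<and> foldr (\<otimes>\<^bsub>G\<^esub>) xs \<one>\<^bsub>G\<^esub> = g)"

definition word_ball :: "('a, 'm) monoid_scheme \<Rightarrow> 'a set \<Rightarrow> nat \<Rightarrow> 'a set" where
  "word_ball G S n = {g \<in> carrier G. word_length G S g \<le> n}"

definition word_sphere :: "('a, 'm) monoid_scheme \<Rightarrow> 'a set \<Rightarrow> nat \<Rightarrow> 'a set" where
  "word_sphere G S r = {g \<in> carrier G. word_length G S g = r}"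

text \<open>Only meaningful for \<open>g\<close> different from the identity.\<close>

definition spherical_curvature ::
    "('a, 'm) monoid_scheme \<Rightarrow> 'a set \<Rightarrow> nat \<Rightarrow> 'a \<Rightarrow> real" where
  "spherical_curvature G S r g =
     (real (word_length G S g)
       - 1 / real (card (word_sphere G S r))
         * (\<Sum>w\<in>word_sphere G S r. real (word_length G S (inv\<^bsub>G\<^esub> w \<otimes>\<^bsub>G\<^esub> g \<otimes>\<^bsub>G\<^esub> w))))
     / real (word_length G S g)"

definition positive_density :: "('a, 'm) monoid_scheme \<Rightarrow> 'a set \<Rightarrow> 'a set \<Rightarrow> bool" where
  "positive_density G S P \<longleftrightarrow>
     liminf (\<lambda>n. ereal (real (card (P \<inter> word_ball G S n)) / real (card (word_ball G S n)))) > 0"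

end

(* Use coordinates (x, y, z) with (x, y, z) (x', y', z') = (x + x', y + y', z + z' + x y'), so that a
   word is a lattice path from 0 to (x, y) and z is its integral of x dy. If 0 <= x <= k <= y and
   z = k y - s with 0 <= s < y, then the best path to enclose z is a detour to the right of width k,
   which gives word length 2 k + y - x; the length jumps by 2 whenever z passes a multiple of y.
   Conjugation by w = (p, q, _) replaces z by z + x q - p y. The part p y moves the length by -2 p and
   averages out over the sphere, which is closed under inversion. What is left is the jump caused by
   x q: if s is close to 0 only q > 0 can jump (upwards), if s is close to y only q < 0 can jump
   (downwards), and in between no q with |q| <= r jumps if x is small against y / r. Each of the
   three regimes contains a positive multiple of n^4 elements of the ball of radius n, which has
   O(n^4) elements. *)

theory Submission
  imports Defs
begin

section \<open>Integer coordinates\<close>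

type_synonym triple = "int \<times> int \<times> int"

text \<open>The product of upper unitriangular integer 3 by 3 matrices with \<open>x\<close>,
  \<open>y\<close> next to the diagonal and \<open>z\<close> in the corner.\<close>

fun heis_mul :: "triple \<Rightarrow> triple \<Rightarrow> triple" where
  "heis_mul (x, y, z) (x', y', z') = (x + x', y + y', z + z' + x * y')"

fun letter_coord :: "gen \<times> bool \<Rightarrow> triple" where
  "letter_coord (GenA, s) = (if s then 1 else - 1, 0, 0)"
| "letter_coord (GenB, s) = (0, if s then 1 else - 1, 0)"

fun word_coord :: "word \<Rightarrow> triple" where
  "word_coord [] = (0, 0, 0)"
| "word_coord (p # w) = heis_mul (letter_coord p) (word_coord w)"

lemma heis_mul_assoc: "heis_mul (heis_mul u v) w = heis_mul u (heis_mul v w)"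
  by (cases u; cases v; cases w) (simp add: algebra_simps)

lemma word_coord_append: "word_coord (u @ v) = heis_mul (word_coord u) (word_coord v)"
proof (induction u)
  case Nil
  show ?case by (cases "word_coord v") simp
qed (simp add: heis_mul_assoc)

text \<open>The commutator of the generators has coordinates \<open>(0, 0, 1)\<close>, which
  commutes with every triple, so the defining relations hold for triples.\<close>

lemma word_coord_heis_eq: "heis_eq u v \<Longrightarrow> word_coord u = word_coord v"
proof (induction rule: heis_eq.induct)
  case (cancel x s)
  show ?case by (cases x) auto
next
  case (central w)
  show ?case by (cases "word_coord w") (simp add: word_coord_append comm_ab_def)
qed (simp_all add: word_coord_append)

lift_definition coord :: "heis \<Rightarrow> triple" is word_coord
  by (rule word_coord_heis_eq)

interpretation Heis: group Heis
  by (rule group_Heis)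

lemma carrier_Heis [simp]: "carrier Heis = UNIV"
  by (simp add: Heis_def)

lemma coord_mult [simp]: "coord (g \<otimes>\<^bsub>Heis\<^esub> h) = heis_mul (coord g) (coord h)"
  unfolding Heis_def by simp (transfer, rule word_coord_append)

lemma coord_one [simp]: "coord \<one>\<^bsub>Heis\<^esub> = (0, 0, 0)"
  unfolding Heis_def by simp (transfer, simp)

lemma coord_a [simp]: "coord heis_a = (1, 0, 0)"
  by transfer simp

lemma coord_b [simp]: "coord heis_b = (0, 1, 0)"
  by transfer simp

lemma coord_inv:
  assumes "coord g = (x, y, z)"
  shows "coord (inv\<^bsub>Heis\<^esub> g) = (- x, - y, x * y - z)"
proof -
  have "heis_mul (coord (inv\<^bsub>Heis\<^esub> g)) (coord g) = (0, 0, 0)"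
    by (metis Heis.l_inv UNIV_I carrier_Heis coord_mult coord_one)
  moreover obtain a b c where inv: "coord (inv\<^bsub>Heis\<^esub> g) = (a, b, c)"
    by (cases "coord (inv\<^bsub>Heis\<^esub> g)")
  ultimately have "a = - x" "b = - y" "c + z + a * y = 0"
    using assms by simp_all
  then show ?thesis
    using inv by simp
qed

lemma coord_inv_gens:
  "coord (inv\<^bsub>Heis\<^esub> heis_a) = (- 1, 0, 0)" "coord (inv\<^bsub>Heis\<^esub> heis_b) = (0, - 1, 0)"
  by (simp_all add: coord_inv[of _ 1 0 0] coord_inv[of _ 0 1 0])

section \<open>Collection into a normal form and injectivity of the coordinates\<close>

lemma (in group) conjugate_int_pow:
  assumes "x \<in> carrier G" "y \<in> carrier G"
  shows "(x \<otimes> y \<otimes> inv x) [^] (n::int) = x \<otimes> y [^] n \<otimes> inv x"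
proof -
  have "group_hom G G (\<lambda>y. x \<otimes> y \<otimes> inv x)"
    using assms(1) by unfold_locales (auto simp: hom_def m_assoc inv_solve_left)
  from group_hom.hom_int_pow[OF this assms(2)] show ?thesis by simp
qed

lemma (in group) commute_int_pow:
  assumes "x \<in> carrier G" "y \<in> carrier G" "x \<otimes> y = y \<otimes> x"
  shows "x [^] (n::int) \<otimes> y = y \<otimes> x [^] n"
proof -
  have "y \<otimes> x \<otimes> inv y = x"
    using assms by (metis inv_solve_right m_closed)
  then have "y \<otimes> x [^] n \<otimes> inv y = x [^] n"
    using conjugate_int_pow[OF assms(2,1)] by metis
  then show ?thesis
    using assms by (metis int_pow_closed inv_solve_right' m_closed)
qed

definition heis_c :: heis where
  "heis_c = heis_a \<otimes>\<^bsub>Heis\<^esub> heis_b \<otimes>\<^bsub>Heis\<^esub> inv\<^bsub>Heis\<^esub> heis_a \<otimes>\<^bsub>Heis\<^esub> inv\<^bsub>Heis\<^esub> heis_b"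

text \<open>With \<open>b\<close> on the left of \<open>a\<close>, \<open>heis_mul\<close> produces
  no cross term, so the three exponents are the coordinates.\<close>

definition heis_elt :: "int \<Rightarrow> int \<Rightarrow> int \<Rightarrow> heis" where
  "heis_elt x y z = heis_b [^]\<^bsub>Heis\<^esub> y \<otimes>\<^bsub>Heis\<^esub> (heis_a [^]\<^bsub>Heis\<^esub> x \<otimes>\<^bsub>Heis\<^esub> heis_c [^]\<^bsub>Heis\<^esub> z)"

lemma abs_heis_append: "abs_heis (u @ v) = abs_heis u \<otimes>\<^bsub>Heis\<^esub> abs_heis v"
  by (simp add: Heis_def heis_mult.abs_eq)

lemma abs_heis_Nil: "abs_heis [] = \<one>\<^bsub>Heis\<^esub>"
  by (simp add: Heis_def heis_one.abs_eq)

lemma abs_heis_inv_letter: "abs_heis [(x, False)] = inv\<^bsub>Heis\<^esub> abs_heis [(x, True)]"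
proof -
  have "abs_heis ([(x, False)] @ [(x, True)]) = \<one>\<^bsub>Heis\<^esub>"
    using heis_eq.cancel[of x False] by (simp add: heis.abs_eq_iff abs_heis_Nil[symmetric])
  then show ?thesis
    by (metis Heis.inv_equality UNIV_I abs_heis_append carrier_Heis)
qed

lemma abs_heis_letter:
  "abs_heis [(GenA, s)] = (if s then heis_a else inv\<^bsub>Heis\<^esub> heis_a)"
  "abs_heis [(GenB, s)] = (if s then heis_b else inv\<^bsub>Heis\<^esub> heis_b)"
  by (simp_all add: abs_heis_inv_letter heis_a.abs_eq heis_b.abs_eq)

lemma abs_heis_surj: obtains w where "g = abs_heis w"
  by (induction g rule: heis.abs_induct) blast

lemma heis_c_eq: "heis_c = abs_heis comm_ab"
proof -
  have "comm_ab = (([(GenA, True)] @ [(GenB, True)]) @ [(GenA, False)]) @ [(GenB, False)]"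
    by (simp add: comm_ab_def)
  then have "abs_heis comm_ab =
      abs_heis ((([(GenA, True)] @ [(GenB, True)]) @ [(GenA, False)]) @ [(GenB, False)])"
    by simp
  then show ?thesis
    unfolding heis_c_def by (simp only: abs_heis_append abs_heis_letter if_True if_False)
qed

lemma heis_c_central: "heis_c \<otimes>\<^bsub>Heis\<^esub> g = g \<otimes>\<^bsub>Heis\<^esub> heis_c"
proof -
  obtain w where "g = abs_heis w" by (rule abs_heis_surj)
  then show ?thesis
    by (simp add: heis_c_eq abs_heis_append[symmetric] heis.abs_eq_iff heis_eq.central)
qed

lemma heis_c_pow_central:
  "heis_c [^]\<^bsub>Heis\<^esub> (n::int) \<otimes>\<^bsub>Heis\<^esub> g = g \<otimes>\<^bsub>Heis\<^esub> heis_c [^]\<^bsub>Heis\<^esub> n"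
  using Heis.commute_int_pow[OF _ _ heis_c_central] by simp

text \<open>Conjugation by \<open>heis_a\<close> turns \<open>heis_b\<close> into
  \<open>heis_c\<close> times \<open>heis_b\<close>; since \<open>heis_c\<close> is central, the
  power splits.\<close>

lemma a_mult_b_pow:
  "heis_a \<otimes>\<^bsub>Heis\<^esub> heis_b [^]\<^bsub>Heis\<^esub> (y::int) =
    heis_b [^]\<^bsub>Heis\<^esub> y \<otimes>\<^bsub>Heis\<^esub> (heis_a \<otimes>\<^bsub>Heis\<^esub> heis_c [^]\<^bsub>Heis\<^esub> y)"
proof -
  have "heis_a \<otimes>\<^bsub>Heis\<^esub> heis_b \<otimes>\<^bsub>Heis\<^esub> inv\<^bsub>Heis\<^esub> heis_a = heis_c \<otimes>\<^bsub>Heis\<^esub> heis_b"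
    by (simp add: heis_c_def Heis.m_assoc)
  then have "heis_a \<otimes>\<^bsub>Heis\<^esub> heis_b [^]\<^bsub>Heis\<^esub> y \<otimes>\<^bsub>Heis\<^esub> inv\<^bsub>Heis\<^esub> heis_a =
      heis_c [^]\<^bsub>Heis\<^esub> y \<otimes>\<^bsub>Heis\<^esub> heis_b [^]\<^bsub>Heis\<^esub> y"
    using Heis.conjugate_int_pow[of heis_a heis_b y]
      Heis.int_pow_mult_distrib[OF heis_c_central, of heis_b y] by simp
  then have "heis_a \<otimes>\<^bsub>Heis\<^esub> heis_b [^]\<^bsub>Heis\<^esub> y =
      heis_c [^]\<^bsub>Heis\<^esub> y \<otimes>\<^bsub>Heis\<^esub> (heis_b [^]\<^bsub>Heis\<^esub> y \<otimes>\<^bsub>Heis\<^esub> heis_a)"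
    by (metis Heis.inv_solve_right' Heis.m_assoc UNIV_I carrier_Heis)
  also have "\<dots> = heis_b [^]\<^bsub>Heis\<^esub> y \<otimes>\<^bsub>Heis\<^esub> (heis_a \<otimes>\<^bsub>Heis\<^esub> heis_c [^]\<^bsub>Heis\<^esub> y)"
    by (simp add: heis_c_pow_central[of y "heis_b [^]\<^bsub>Heis\<^esub> y \<otimes>\<^bsub>Heis\<^esub> heis_a"] Heis.m_assoc)
  finally show ?thesis .
qed

text \<open>Collecting a letter changes the exponents exactly as \<open>heis_mul\<close> changes
  coordinates: moving \<open>a\<close> across the power of \<open>b\<close> is what adds
  \<open>y\<close> to \<open>z\<close>.\<close>

lemma a_mult_heis_elt: "heis_a \<otimes>\<^bsub>Heis\<^esub> heis_elt x y z = heis_elt (x + 1) y (z + y)"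
proof -
  have "heis_a \<otimes>\<^bsub>Heis\<^esub> heis_elt x y z = heis_a \<otimes>\<^bsub>Heis\<^esub> heis_b [^]\<^bsub>Heis\<^esub> y \<otimes>\<^bsub>Heis\<^esub>
      (heis_a [^]\<^bsub>Heis\<^esub> x \<otimes>\<^bsub>Heis\<^esub> heis_c [^]\<^bsub>Heis\<^esub> z)"
    by (simp add: heis_elt_def Heis.m_assoc)
  also have "\<dots> = heis_b [^]\<^bsub>Heis\<^esub> y \<otimes>\<^bsub>Heis\<^esub> (heis_a \<otimes>\<^bsub>Heis\<^esub>
      (heis_c [^]\<^bsub>Heis\<^esub> y \<otimes>\<^bsub>Heis\<^esub> (heis_a [^]\<^bsub>Heis\<^esub> x \<otimes>\<^bsub>Heis\<^esub> heis_c [^]\<^bsub>Heis\<^esub> z)))"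
    by (simp add: a_mult_b_pow Heis.m_assoc)
  also have "heis_c [^]\<^bsub>Heis\<^esub> y \<otimes>\<^bsub>Heis\<^esub> (heis_a [^]\<^bsub>Heis\<^esub> x \<otimes>\<^bsub>Heis\<^esub> heis_c [^]\<^bsub>Heis\<^esub> z) =
      heis_a [^]\<^bsub>Heis\<^esub> x \<otimes>\<^bsub>Heis\<^esub> heis_c [^]\<^bsub>Heis\<^esub> (z + y)"
    by (simp add: heis_c_pow_central[of y "heis_a [^]\<^bsub>Heis\<^esub> x \<otimes>\<^bsub>Heis\<^esub> heis_c [^]\<^bsub>Heis\<^esub> z"]
        Heis.m_assoc Heis.int_pow_mult)
  finally show ?thesis
    by (simp add: heis_elt_def Heis.int_pow_mult Heis.m_assoc[symmetric] add.commute[of x 1])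
qed

lemma b_mult_heis_elt: "heis_b \<otimes>\<^bsub>Heis\<^esub> heis_elt x y z = heis_elt x (y + 1) z"
  by (simp add: heis_elt_def Heis.int_pow_mult Heis.m_assoc[symmetric] add.commute[of y 1])

lemma inv_mult_heis_elt:
  "inv\<^bsub>Heis\<^esub> heis_a \<otimes>\<^bsub>Heis\<^esub> heis_elt x y z = heis_elt (x - 1) y (z - y)"
  "inv\<^bsub>Heis\<^esub> heis_b \<otimes>\<^bsub>Heis\<^esub> heis_elt x y z = heis_elt x (y - 1) z"
  using a_mult_heis_elt[of "x - 1" y "z - y"] b_mult_heis_elt[of x "y - 1" z]
  by (simp_all add: Heis.inv_solve_left')

text \<open>Induction over a word collects its letters into the normal form. Hence every relation
  between triples already follows from the presentation, and an element is recovered from its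
  coordinates.\<close>

lemma heis_elt_coord:
  assumes "coord g = (x, y, z)"
  shows "g = heis_elt x y z"
proof -
  have "abs_heis w = heis_elt (fst (word_coord w)) (fst (snd (word_coord w))) (snd (snd (word_coord w)))"
    for w
  proof (induction w)
    case Nil
    show ?case by (simp add: heis_elt_def abs_heis_Nil)
  next
    case (Cons p w)
    obtain u s where p: "p = (u, s)" by (cases p)
    obtain x y z where w: "word_coord w = (x, y, z)" by (cases "word_coord w")
    have "abs_heis (p # w) = abs_heis [p] \<otimes>\<^bsub>Heis\<^esub> heis_elt x y z"
      using Cons.IH w abs_heis_append[of "[p]" w] by simp
    then show ?case
      by (cases u) (auto simp: p w abs_heis_letter a_mult_heis_elt b_mult_heis_elt
        inv_mult_heis_elt add.commute)
  qed
  moreover obtain w where "g = abs_heis w" by (rule abs_heis_surj)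
  ultimately show ?thesis
    using assms by (metis coord.abs_eq fst_conv snd_conv)
qed

lemma inj_coord: "inj coord"
  by (rule injI) (metis heis_elt_coord prod_cases3)

section \<open>Word length\<close>

abbreviation heis_prod :: "heis list \<Rightarrow> heis" where
  "heis_prod xs \<equiv> foldr (\<otimes>\<^bsub>Heis\<^esub>) xs \<one>\<^bsub>Heis\<^esub>"

abbreviation heis_length :: "heis \<Rightarrow> nat" where
  "heis_length \<equiv> word_length Heis heis_gens"

text \<open>Guarantees that the \<open>LEAST\<close> in \<open>word_length\<close> is
  attained.\<close>

lemma heis_gens_generate: "\<exists>xs. set xs \<subseteq> heis_gens \<and> heis_prod xs = g"
proof -
  have "\<exists>xs. set xs \<subseteq> heis_gens \<and> heis_prod xs = abs_heis w" for w
  proof (induction w)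
    case Nil
    show ?case by (intro exI[of _ "[]"]) (simp add: abs_heis_Nil)
  next
    case (Cons p w)
    then obtain xs where "set xs \<subseteq> heis_gens" "heis_prod xs = abs_heis w" by blast
    moreover have "abs_heis [p] \<in> heis_gens"
      by (cases p; cases "fst p") (auto simp: abs_heis_letter heis_gens_def)
    ultimately show ?case
      using abs_heis_append[of "[p]" w] by (intro exI[of _ "abs_heis [p] # xs"]) simp
  qed
  moreover obtain w where "g = abs_heis w" by (rule abs_heis_surj)
  ultimately show ?thesis by simp
qed

lemma heis_length_attained:
  "\<exists>xs. set xs \<subseteq> heis_gens \<and> length xs = heis_length g \<and> heis_prod xs = g"
proof -
  have "\<exists>n xs. set xs \<subseteq> heis_gens \<and> length xs = n \<and> heis_prod xs = g"
    using heis_gens_generate by simp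
  from LeastI_ex[OF this] show ?thesis unfolding word_length_def .
qed

lemma heis_length_le:
  "set xs \<subseteq> heis_gens \<Longrightarrow> heis_length (heis_prod xs) \<le> length xs"
  unfolding word_length_def by (rule Least_le) auto

lemma heis_prod_append: "heis_prod (xs @ ys) = heis_prod xs \<otimes>\<^bsub>Heis\<^esub> heis_prod ys"
  by (induction xs) (simp_all add: Heis.m_assoc)

lemma heis_prod_inv: "heis_prod (rev (map (m_inv Heis) xs)) = inv\<^bsub>Heis\<^esub> heis_prod xs"
  by (induction xs) (simp_all add: heis_prod_append Heis.inv_mult_group del: foldr_append)

text \<open>The generating set is symmetric: reversing a shortest word and inverting its letters
  gives a word of the same length for the inverse.\<close>

lemma heis_length_inv [simp]: "heis_length (inv\<^bsub>Heis\<^esub> g) = heis_length g"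
proof -
  have le: "heis_length (inv\<^bsub>Heis\<^esub> g) \<le> heis_length g" for g
  proof -
    obtain xs where xs: "set xs \<subseteq> heis_gens" "length xs = heis_length g" "heis_prod xs = g"
      using heis_length_attained by blast
    have "set (rev (map (m_inv Heis) xs)) \<subseteq> heis_gens"
      using xs(1) by (auto simp: heis_gens_def)
    from heis_length_le[OF this] show ?thesis
      using xs by (simp add: heis_prod_inv)
  qed
  from le[of g] le[of "inv\<^bsub>Heis\<^esub> g"] show ?thesis by simp
qed

section \<open>Lower bounds for the word length\<close>

lemma coord_bounds:
  assumes "coord g = (x, y, z)" "heis_length g \<le> n"
  shows "\<bar>x\<bar> \<le> int n" "\<bar>y\<bar> \<le> int n" "\<bar>z\<bar> \<le> (int n)\<^sup>2"
proof -
  have bound: "set xs \<subseteq> heis_gens \<Longrightarrow> \<exists>x y z. coord (heis_prod xs) = (x, y, z) \<and>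
      \<bar>x\<bar> \<le> int (length xs) \<and> \<bar>y\<bar> \<le> int (length xs) \<and> \<bar>z\<bar> \<le> (int (length xs))\<^sup>2" for xs
  proof (induction xs)
    case (Cons g xs)
    then obtain x y z where IH: "coord (heis_prod xs) = (x, y, z)" "\<bar>x\<bar> \<le> int (length xs)"
      "\<bar>y\<bar> \<le> int (length xs)" "\<bar>z\<bar> \<le> (int (length xs))\<^sup>2" by auto
    have "g \<in> heis_gens" using Cons.prems by simp
    \<comment> \<open>Prepending \<open>a\<close> or its inverse changes \<open>z\<close> by the
      height \<open>y\<close>, and \<open>n^2 + n <= (n + 1)^2\<close>.\<close>
    moreover have "\<bar>z\<bar> + \<bar>y\<bar> \<le> (int (length (g # xs)))\<^sup>2"
      using IH by (simp add: power2_eq_square algebra_simps)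
    ultimately show ?case
      using IH unfolding heis_gens_def by (auto simp: coord_inv_gens abs_le_iff)
  qed simp
  obtain xs where xs: "set xs \<subseteq> heis_gens" "length xs = heis_length g" "heis_prod xs = g"
    using heis_length_attained by blast
  have "\<bar>x\<bar> \<le> int (heis_length g)" "\<bar>y\<bar> \<le> int (heis_length g)"
    "\<bar>z\<bar> \<le> (int (heis_length g))\<^sup>2"
    using bound[OF xs(1)] xs assms(1) by simp_all
  moreover have "(int (heis_length g))\<^sup>2 \<le> (int n)\<^sup>2"
    using assms(2) by (intro power_mono) auto
  ultimately show "\<bar>x\<bar> \<le> int n" "\<bar>y\<bar> \<le> int n" "\<bar>z\<bar> \<le> (int n)\<^sup>2"
    using assms(2) by linarith+
qed

text \<open>Here \<open>R, L, U, D\<close> count the letters \<open>a, a\<inverse>, b, b\<inverse>\<close>, and \<open>- m\<close> and \<open>M\<close> bound the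
  heights of the suffixes of the word.  If the heights span \<open>M + m\<close> and the word ends on the upper
  side, then it needs \<open>M + m\<close> letters \<open>b\<close>.\<close>

lemma area_bound:
  assumes "set xs \<subseteq> heis_gens"
  shows "\<exists>R L U D M m z. coord (heis_prod xs) = (R - L, U - D, z) \<and>
    int (length xs) = R + L + U + D \<and> 0 \<le> R \<and> 0 \<le> L \<and> 0 \<le> M \<and> 0 \<le> m \<and> M \<le> U \<and> m \<le> D \<and>
    U - D \<le> M \<and> D - U \<le> m \<and> (M + m \<le> U \<or> M + m \<le> D) \<and> z \<le> M * R + m * L"
  using assms
proof (induction xs)
  case Nil
  show ?case by (intro exI[of _ 0]) simp
next
  case (Cons g xs)
  then obtain R L U D M m z where IH: "coord (heis_prod xs) = (R - L, U - D, z)"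
    "int (length xs) = R + L + U + D" "0 \<le> R" "0 \<le> L" "0 \<le> M" "0 \<le> m" "M \<le> U" "m \<le> D"
    "U - D \<le> M" "D - U \<le> m" "M + m \<le> U \<or> M + m \<le> D" "z \<le> M * R + m * L"
    by auto
  have g: "g \<in> heis_gens" using Cons.prems by simp
  then consider "g = heis_a" | "g = inv\<^bsub>Heis\<^esub> heis_a" | "g = heis_b" | "g = inv\<^bsub>Heis\<^esub> heis_b"
    unfolding heis_gens_def by blast
  then show ?case
  proof cases
    case 1
    \<comment> \<open>Prepending \<open>a\<close> adds the height \<open>U - D <= M\<close> of the
      old word to \<open>z\<close>.\<close>
    have "coord (heis_prod (g # xs)) = (R + 1 - L, U - D, z + (U - D))"
      "z + (U - D) \<le> M * (R + 1) + m * L" "int (length (g # xs)) = R + 1 + L + U + D"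
      using IH(1,2,9,12) 1 by (simp_all add: distrib_left)
    with IH show ?thesis
      by - (rule exI[of _ "R + 1"], rule exI[of _ "L"],
          rule exI[of _ "U"], rule exI[of _ "D"],
          rule exI[of _ "M"], rule exI[of _ "m"],
          rule exI[of _ "z + (U - D)"],
          simp)
  next
    case 2
    have "coord (heis_prod (g # xs)) = (R - (L + 1), U - D, z - (U - D))"
      "z - (U - D) \<le> M * R + m * (L + 1)" "int (length (g # xs)) = R + (L + 1) + U + D"
      using IH(1,2,10,12) 2 by (simp_all add: distrib_left coord_inv_gens)
    with IH show ?thesis
      by - (rule exI[of _ "R"], rule exI[of _ "L + 1"],
          rule exI[of _ "U"], rule exI[of _ "D"],
          rule exI[of _ "M"], rule exI[of _ "m"],
          rule exI[of _ "z - (U - D)"],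
          simp)
  next
    case 3
    \<comment> \<open>The extended word is the only new suffix and has height
      \<open>U + 1 - D\<close>. If this is a new maximum, \<open>m <= D\<close> gives
      \<open>M' + m <= U + 1\<close>; otherwise the old alternative carries over.\<close>
    define M' where "M' = max M (U + 1 - D)"
    have "M * R \<le> M' * R"
      using IH(3) by (intro mult_right_mono) (simp_all add: M'_def)
    then have "z \<le> M' * R + m * L" using IH(12) by linarith
    moreover have "0 \<le> M'" "M' \<le> U + 1" "U + 1 - D \<le> M'" "D - (U + 1) \<le> m"
      "M' + m \<le> U + 1 \<or> M' + m \<le> D"
      using IH(5-11) unfolding M'_def by linarith+
    moreover have "coord (heis_prod (g # xs)) = (R - L, U + 1 - D, z)"
      "int (length (g # xs)) = R + L + (U + 1) + D"
      using IH(1,2) 3 by simp_all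
    ultimately show ?thesis
      using IH
      by - (rule exI[of _ "R"], rule exI[of _ "L"],
          rule exI[of _ "U + 1"], rule exI[of _ "D"],
          rule exI[of _ "M'"], rule exI[of _ "m"],
          rule exI[of _ "z"],
          simp)
  next
    case 4
    define m' where "m' = max m (D + 1 - U)"
    have "m * L \<le> m' * L"
      using IH(4) by (intro mult_right_mono) (simp_all add: m'_def)
    then have "z \<le> M * R + m' * L" using IH(12) by linarith
    moreover have "0 \<le> m'" "m' \<le> D + 1" "U - (D + 1) \<le> M" "D + 1 - U \<le> m'"
      "M + m' \<le> U \<or> M + m' \<le> D + 1"
      using IH(5-11) unfolding m'_def by linarith+
    moreover have "coord (heis_prod (g # xs)) = (R - L, U - (D + 1), z)"
      "int (length (g # xs)) = R + L + U + (D + 1)"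
      using IH(1,2) 4 by (simp_all add: coord_inv_gens)
    ultimately show ?thesis
      using IH
      by - (rule exI[of _ "R"], rule exI[of _ "L"],
          rule exI[of _ "U"], rule exI[of _ "D + 1"],
          rule exI[of _ "M"], rule exI[of _ "m'"],
          rule exI[of _ "z"],
          simp)
  qed
qed


text \<open>As \<open>y > 0\<close>, the height span is at most \<open>U\<close>; with
  \<open>L <= R\<close> the area is at most \<open>U * R\<close>. The length is
  \<open>2 * (R + U) - x - y\<close>, so it remains to bound \<open>R + U\<close> from below, and
  for \<open>k <= y\<close> the cheapest rectangle has height \<open>y\<close> and width
  \<open>k\<close>.\<close>

lemma heis_length_ge:
  assumes "coord g = (x, y, k * y - s)" "0 \<le> x" "k \<le> y" "0 \<le> s" "s < y"
  shows "2 * k + y - x \<le> int (heis_length g)"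
proof -
  obtain xs where xs: "set xs \<subseteq> heis_gens" "length xs = heis_length g" "heis_prod xs = g"
    using heis_length_attained by blast
  obtain R L U D M m z where P: "coord g = (R - L, U - D, z)"
    "int (heis_length g) = R + L + U + D" "0 \<le> R" "0 \<le> L" "0 \<le> M" "0 \<le> m" "M \<le> U" "m \<le> D"
    "M + m \<le> U \<or> M + m \<le> D" "z \<le> M * R + m * L"
    using area_bound[OF xs(1)] unfolding xs by blast
  have eqs: "x = R - L" "y = U - D" "z = k * y - s"
    using P(1) assms(1) by auto
  have "L \<le> R" "M + m \<le> U" "y \<le> U"
    using eqs P assms by linarith+
  have "z \<le> M * R + m * R"
    using P(10) mult_left_mono[OF \<open>L \<le> R\<close> P(6)] by linarith
  also have "\<dots> \<le> U * R"
    using mult_right_mono[OF \<open>M + m \<le> U\<close> P(3)] by (simp add: distrib_right)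
  \<comment> \<open>Since \<open>s < y\<close>, a width of \<open>k - 1\<close> at height
    \<open>y\<close> does not suffice.\<close>
  finally have area: "(k - 1) * y < U * R"
    using eqs(3) assms(5) unfolding left_diff_distrib by linarith
  have "k + y \<le> R + U"
  proof (rule ccontr)
    assume "\<not> k + y \<le> R + U"
    \<comment> \<open>\<open>j\<close> is the excess height, paid for by \<open>j\<close> fewer
      steps to the right; as \<open>k <= y\<close>, this exchange never gains area.\<close>
    define j where "j = U - y"
    have "0 \<le> j" "R \<le> k - 1 - j"
      using \<open>\<not> k + y \<le> R + U\<close> \<open>y \<le> U\<close> by (simp_all add: j_def)
    then have "U * R \<le> U * (k - 1 - j)"
      using \<open>y \<le> U\<close> assms by (intro mult_left_mono) simp_all
    also have "\<dots> = (k - 1) * y - j * (y + j + 1 - k)"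
      by (simp add: j_def algebra_simps)
    also have "\<dots> \<le> (k - 1) * y"
      using \<open>0 \<le> j\<close> assms(3) by simp
    finally show False using area by simp
  qed
  then show ?thesis
    using P(2) eqs by linarith
qed

section \<open>Short words with prescribed coordinates\<close>

lemma coord_heis_prod_replicate:
  "coord (heis_prod (replicate n heis_a)) = (int n, 0, 0)"
  "coord (heis_prod (replicate n heis_b)) = (0, int n, 0)"
  "coord (heis_prod (replicate n (inv\<^bsub>Heis\<^esub> heis_a))) = (- int n, 0, 0)"
  by (induction n) (simp_all add: coord_inv_gens)

text \<open>The witness goes \<open>k\<close> steps to the right, \<open>y\<close> up and \<open>k - x\<close> to the left, where the \<open>k\<close>-th step
  to the right is delayed until height \<open>s\<close> to lose the excess area \<open>s\<close>.\<close>

lemma heis_elt_exists: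
  assumes "x \<le> k" "1 \<le> k" "0 \<le> s" "s \<le> y"
  obtains g where "coord g = (x, y, k * y - s)" "int (heis_length g) \<le> 2 * k + y - x"
proof
  define xs where "xs = replicate (nat (k - 1)) heis_a @ replicate (nat s) heis_b @ [heis_a] @
    replicate (nat (y - s)) heis_b @ replicate (nat (k - x)) (inv\<^bsub>Heis\<^esub> heis_a)"
  have "set xs \<subseteq> heis_gens"
    by (auto simp: xs_def heis_gens_def)
  moreover have "int (length xs) = 2 * k + y - x"
    using assms by (simp add: xs_def)
  ultimately show "int (heis_length (heis_prod xs)) \<le> 2 * k + y - x"
    using heis_length_le by fastforce
  have "coord (heis_prod [heis_a]) = (1, 0, 0)" by simp
  then show "coord (heis_prod xs) = (x, y, k * y - s)"
    using assms unfolding xs_def heis_prod_append coord_mult coord_heis_prod_replicate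
    by (simp add: algebra_simps)
qed

text \<open>By injectivity of \<open>coord\<close> the explicit word represents \<open>g\<close>
  itself, so its length meets the lower bound.\<close>

lemma heis_length_eq:
  assumes "coord g = (x, y, k * y - s)" "0 \<le> x" "x \<le> k" "1 \<le> k" "k \<le> y" "0 \<le> s" "s < y"
  shows "int (heis_length g) = 2 * k + y - x"
proof -
  obtain h where "coord h = (x, y, k * y - s)" "int (heis_length h) \<le> 2 * k + y - x"
    using heis_elt_exists[of x k s y] assms by auto
  moreover have "h = g"
    using injD[OF inj_coord] calculation assms(1) by metis
  ultimately show ?thesis
    using heis_length_ge[of g x y k s] assms by simp
qed

section \<open>Balls and spheres\<close>

text \<open>The ball embeds into a coordinate box with sides of order \<open>n\<close>,
  \<open>n\<close> and \<open>n^2\<close>.\<close>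

lemma finite_word_ball: "finite (word_ball Heis heis_gens n)"
  and card_word_ball_le:
    "card (word_ball Heis heis_gens n) \<le> (2 * n + 1) * ((2 * n + 1) * (2 * n\<^sup>2 + 1))"
proof -
  let ?I = "\<lambda>k. {- int k..int k}"
  have sub: "coord ` word_ball Heis heis_gens n \<subseteq> ?I n \<times> ?I n \<times> ?I (n\<^sup>2)"
  proof
    fix c assume "c \<in> coord ` word_ball Heis heis_gens n"
    then obtain g where g: "c = coord g" "heis_length g \<le> n"
      by (auto simp: word_ball_def)
    obtain x y z where "coord g = (x, y, z)" by (cases "coord g")
    then show "c \<in> ?I n \<times> ?I n \<times> ?I (n\<^sup>2)"
      using coord_bounds[of g x y z n] g by (simp add: abs_le_iff)
  qed
  have inj: "inj_on coord (word_ball Heis heis_gens n)"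
    using inj_coord by (rule inj_on_subset) simp
  show "finite (word_ball Heis heis_gens n)"
    using finite_subset[OF sub] inj by (simp add: finite_image_iff)
  have "card (word_ball Heis heis_gens n) \<le> card (?I n \<times> ?I n \<times> ?I (n\<^sup>2))"
    using card_mono[OF _ sub] inj by (simp add: card_image)
  also have "\<dots> = (2 * n + 1) * ((2 * n + 1) * (2 * n\<^sup>2 + 1))"
  proof -
    have card_I: "card (?I k) = 2 * k + 1" for k by simp
    show ?thesis by (simp only: card_cartesian_product card_I)
  qed
  finally show "card (word_ball Heis heis_gens n) \<le> (2 * n + 1) * ((2 * n + 1) * (2 * n\<^sup>2 + 1))" .
qed

abbreviation heis_sphere :: "nat \<Rightarrow> heis set" where
  "heis_sphere \<equiv> word_sphere Heis heis_gens"

lemma mem_heis_sphere: "w \<in> heis_sphere r \<longleftrightarrow> heis_length w = r"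
  by (simp add: word_sphere_def)

lemma finite_heis_sphere: "finite (heis_sphere r)"
  by (rule finite_subset[OF _ finite_word_ball[of r]]) (auto simp: word_sphere_def word_ball_def)

text \<open>No shorter word exists because the \<open>y\<close>-coordinate is bounded by the length.
  This element makes the sphere nonempty, and for \<open>r >= 1\<close> it and its inverse witness
  both signs of \<open>coord_y\<close>.\<close>

lemma b_pow_mem_heis_sphere: "heis_prod (replicate r heis_b) \<in> heis_sphere r"
proof -
  have "set (replicate r heis_b) \<subseteq> heis_gens"
    by (auto simp: heis_gens_def)
  from heis_length_le[OF this] have "heis_length (heis_prod (replicate r heis_b)) \<le> r"
    by simp
  moreover have "r \<le> heis_length (heis_prod (replicate r heis_b))"
    using coord_bounds(2)[OF coord_heis_prod_replicate(2) order.refl, of r] by simp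
  ultimately show ?thesis by (simp add: mem_heis_sphere)
qed

definition coord_x :: "heis \<Rightarrow> int" where "coord_x g = fst (coord g)"

definition coord_y :: "heis \<Rightarrow> int" where "coord_y g = fst (snd (coord g))"

lemma coord_xy_inv:
  "coord_x (inv\<^bsub>Heis\<^esub> g) = - coord_x g" "coord_y (inv\<^bsub>Heis\<^esub> g) = - coord_y g"
  by (cases "coord g"; simp add: coord_x_def coord_y_def coord_inv)+

lemma coord_y_b_pow: "coord_y (heis_prod (replicate r heis_b)) = int r"
  by (simp only: coord_y_def coord_heis_prod_replicate fst_conv snd_conv)

lemma bij_betw_inv_heis_sphere: "bij_betw (m_inv Heis) (heis_sphere r) (heis_sphere r)"
  by (rule bij_betwI[of _ _ _ "m_inv Heis"]) (auto simp: mem_heis_sphere)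

text \<open>Inversion permutes the sphere and negates \<open>coord_x\<close>, so the sum equals its
  own negative.\<close>

lemma sum_coord_x_sphere: "(\<Sum>w\<in>heis_sphere r. coord_x w) = 0"
proof -
  have "(\<Sum>w\<in>heis_sphere r. coord_x w) = (\<Sum>w\<in>heis_sphere r. coord_x (inv\<^bsub>Heis\<^esub> w))"
    using sum.reindex_bij_betw[OF bij_betw_inv_heis_sphere] by metis
  then show ?thesis
    by (simp add: coord_xy_inv sum_negf)
qed

section \<open>Curvature\<close>

text \<open>The \<open>x\<close>-coordinate of \<open>w\<close> averages out over the sphere, so the sign of the curvature is decided
  by \<open>e\<close>.\<close>

lemma spherical_curvature_eq:
  assumes "\<And>w. w \<in> heis_sphere r \<Longrightarrow>
      int (heis_length (inv\<^bsub>Heis\<^esub> w \<otimes>\<^bsub>Heis\<^esub> g \<otimes>\<^bsub>Heis\<^esub> w)) = int (heis_length g) + 2 * (e (coord_y w) - coord_x w)"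
  shows "spherical_curvature Heis heis_gens r g =
    - real_of_int (2 * (\<Sum>w\<in>heis_sphere r. e (coord_y w))) /
      (real (card (heis_sphere r)) * real (heis_length g))"
proof -
  let ?S = "heis_sphere r"
  have "card ?S > 0"
    using b_pow_mem_heis_sphere finite_heis_sphere by (auto simp: card_gt_0_iff)
  have "(\<Sum>w\<in>?S. real (heis_length (inv\<^bsub>Heis\<^esub> w \<otimes>\<^bsub>Heis\<^esub> g \<otimes>\<^bsub>Heis\<^esub> w))) =
      real_of_int (\<Sum>w\<in>?S. int (heis_length (inv\<^bsub>Heis\<^esub> w \<otimes>\<^bsub>Heis\<^esub> g \<otimes>\<^bsub>Heis\<^esub> w)))"
    by simp
  also have "(\<Sum>w\<in>?S. int (heis_length (inv\<^bsub>Heis\<^esub> w \<otimes>\<^bsub>Heis\<^esub> g \<otimes>\<^bsub>Heis\<^esub> w))) =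
      (\<Sum>w\<in>?S. int (heis_length g) + 2 * (e (coord_y w) - coord_x w))"
    by (rule sum.cong[OF HOL.refl assms])
  also have "\<dots> = int (card ?S) * int (heis_length g) + 2 * (\<Sum>w\<in>?S. e (coord_y w))"
    by (simp add: sum.distrib sum_distrib_left[symmetric] sum_subtractf sum_coord_x_sphere)
  finally show ?thesis
    using \<open>card ?S > 0\<close> unfolding spherical_curvature_def
    \<comment> \<open>At length 0 both sides are divisions by 0 and therefore 0.\<close>
    by (cases "heis_length g = 0") (simp_all add: field_simps)
qed

text \<open>Here \<open>e\<close> is the carry that brings the shifted remainder
  \<open>s - x * coord_y w\<close> back into the range from 0 to \<open>y - 1\<close>; the new width
  is \<open>k + e - coord_x w\<close>. The margins in terms of \<open>m\<close> keep both widths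
  between \<open>x\<close> and \<open>y\<close>, so \<open>heis_length_eq\<close> applies before and
  after conjugation.\<close>

lemma heis_length_conjugate:
  assumes g: "coord g = (x, y, k * y - s)" and w: "w \<in> heis_sphere r"
    and "int r < m" "0 \<le> x" "x < 2 * m" "3 * m \<le> k" "k < 4 * m" "8 * m \<le> y" "0 \<le> s" "s < y"
    and e: "\<bar>e\<bar> \<le> 1" "0 \<le> s - x * coord_y w + e * y" "s - x * coord_y w + e * y < y"
  shows "int (heis_length (inv\<^bsub>Heis\<^esub> w \<otimes>\<^bsub>Heis\<^esub> g \<otimes>\<^bsub>Heis\<^esub> w)) = int (heis_length g) + 2 * (e - coord_x w)"
proof -
  obtain p q u where c: "coord w = (p, q, u)" by (cases "coord w")
  then have xy: "coord_x w = p" "coord_y w = q"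
    by (simp_all add: coord_x_def coord_y_def)
  have p: "\<bar>p\<bar> \<le> int r"
    using coord_bounds(1)[OF c] w by (simp add: mem_heis_sphere)
  have "coord (inv\<^bsub>Heis\<^esub> w \<otimes>\<^bsub>Heis\<^esub> g \<otimes>\<^bsub>Heis\<^esub> w) =
      (x, y, (k + e - p) * y - (s - x * q + e * y))"
    by (simp add: g c coord_inv[OF c] algebra_simps)
  then have "int (heis_length (inv\<^bsub>Heis\<^esub> w \<otimes>\<^bsub>Heis\<^esub> g \<otimes>\<^bsub>Heis\<^esub> w)) = 2 * (k + e - p) + y - x"
    by (rule heis_length_eq) (use assms(3-8) e[unfolded xy] p in linarith)+
  moreover have "int (heis_length g) = 2 * k + y - x"
    using g by (rule heis_length_eq) (use assms in linarith)+
  ultimately show ?thesis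
    by (simp add: xy)
qed

text \<open>In the regimes below, where \<open>8 * (int r * m) <= y\<close>, the shift is at most a
  quarter of \<open>y\<close>, so a remainder passes at most one multiple of
  \<open>y\<close>.\<close>

lemma shift_bound:
  assumes "w \<in> heis_sphere r" "0 \<le> x" "x < 2 * m"
  shows "\<bar>x * coord_y w\<bar> \<le> 2 * (int r * m)"
proof -
  have "\<bar>coord_y w\<bar> \<le> int r"
    using assms(1) by (cases "coord w") (auto simp: coord_y_def mem_heis_sphere intro: coord_bounds(2))
  then have "\<bar>x * coord_y w\<bar> \<le> (2 * m) * int r"
    using assms unfolding abs_mult by (intro mult_mono) simp_all
  then show ?thesis by (simp add: algebra_simps)
qed

section \<open>The sign of the curvature in three regimes of the remainder\<close>

lemma sum_of_bool_pos:
  assumes "finite A" "a \<in> A" "Q a"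
  shows "(0::int) < (\<Sum>w\<in>A. of_bool (Q w))"
  using assms by (intro sum_pos2[of _ a]) simp_all

text \<open>Since \<open>s < m <= x\<close>, every \<open>w\<close> with
  \<open>coord_y w > 0\<close> makes the remainder negative and forces the carry 1, while the others
  cause none. The average length thus grows.\<close>

lemma spherical_curvature_neg:
  assumes "r \<ge> 1" "coord g = (x, y, k * y - s)" "int r < m" "m \<le> x" "x < 2 * m"
    "8 * (int r * m) \<le> y" "3 * m \<le> k" "k < 4 * m" "0 \<le> s" "s < m"
  shows "spherical_curvature Heis heis_gens r g < 0"
proof -
  define e :: "int \<Rightarrow> int" where "e q = of_bool (0 < q)" for q
  define N where "N = int r * m"
  have N: "m \<le> N" "8 * N \<le> y" using assms(1,3,6) by (simp_all add: N_def)
  have pos: "int (heis_length g) = 2 * k + y - x"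
    using assms(2) by (rule heis_length_eq) (use assms N in linarith)+
  have eq: "spherical_curvature Heis heis_gens r g =
    - real_of_int (2 * (\<Sum>w\<in>heis_sphere r. e (coord_y w))) /
      (real (card (heis_sphere r)) * real (heis_length g))"
  proof (rule spherical_curvature_eq)
    fix w assume w: "w \<in> heis_sphere r"
    have shift: "\<bar>x * coord_y w\<bar> \<le> 2 * N"
      using shift_bound[OF w] assms by (simp add: N_def)
    have "0 \<le> s - x * coord_y w + e (coord_y w) * y \<and> s - x * coord_y w + e (coord_y w) * y < y"
    proof (cases "0 < coord_y w")
      case True
      have "x \<le> x * coord_y w" "e (coord_y w) = 1"
        using True assms by (simp_all add: e_def)
      then show ?thesis
        unfolding \<open>e (coord_y w) = 1\<close> using shift assms(4,9,10) N by linarith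
    next
      case False
      have "x * coord_y w \<le> 0" "e (coord_y w) = 0"
        using False assms by (simp_all add: e_def mult_nonneg_nonpos)
      then show ?thesis
        using shift assms(9,10) N by simp
    qed
    then show "int (heis_length (inv\<^bsub>Heis\<^esub> w \<otimes>\<^bsub>Heis\<^esub> g \<otimes>\<^bsub>Heis\<^esub> w)) =
        int (heis_length g) + 2 * (e (coord_y w) - coord_x w)"
      using heis_length_conjugate[OF assms(2) w assms(3) _ assms(5,7,8), of "e (coord_y w)"] assms N
      by (simp add: e_def)
  qed
  have "(0::int) < (\<Sum>w\<in>heis_sphere r. e (coord_y w))"
    unfolding e_def
    by (rule sum_of_bool_pos[OF finite_heis_sphere b_pow_mem_heis_sphere])
      (use assms(1) in \<open>simp add: coord_y_b_pow del: foldr_replicate\<close>)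
  moreover have "0 < card (heis_sphere r)"
    using b_pow_mem_heis_sphere finite_heis_sphere by (auto simp: card_gt_0_iff)
  moreover have "0 < heis_length g"
    using pos assms N by linarith
  ultimately show ?thesis
    unfolding eq by (intro divide_neg_pos mult_pos_pos) (simp_all del: of_int_sum)
qed

text \<open>The remainder keeps a distance of at least the maximal shift from both 0 and
  \<open>y\<close>, so no carry ever occurs.\<close>

lemma spherical_curvature_zero:
  assumes "r \<ge> 1" "coord g = (x, y, k * y - s)" "int r < m" "m \<le> x" "x < 2 * m"
    "8 * (int r * m) \<le> y" "3 * m \<le> k" "k < 4 * m" "2 * (int r * m) \<le> s" "s < 3 * (int r * m)"
  shows "spherical_curvature Heis heis_gens r g = 0"
proof -
  define N where "N = int r * m"
  have N: "m \<le> N" "8 * N \<le> y" using assms(1,3,6) by (simp_all add: N_def)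
  have "spherical_curvature Heis heis_gens r g =
    - real_of_int (2 * (\<Sum>w\<in>heis_sphere r. (\<lambda>_. 0) (coord_y w))) /
      (real (card (heis_sphere r)) * real (heis_length g))"
  proof (rule spherical_curvature_eq)
    fix w assume w: "w \<in> heis_sphere r"
    have "\<bar>x * coord_y w\<bar> \<le> 2 * N"
      using shift_bound[OF w] assms by (simp add: N_def)
    then show "int (heis_length (inv\<^bsub>Heis\<^esub> w \<otimes>\<^bsub>Heis\<^esub> g \<otimes>\<^bsub>Heis\<^esub> w)) =
        int (heis_length g) + 2 * (0 - coord_x w)"
      using assms N unfolding N_def[symmetric]
      by (intro heis_length_conjugate[OF assms(2) w assms(3)]; simp)
  qed
  then show ?thesis by simp
qed

text \<open>Mirror image of the negative regime: \<open>s\<close> is within \<open>m <= x\<close> of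
  \<open>y\<close>, so exactly the \<open>w\<close> with \<open>coord_y w < 0\<close> push the
  remainder to \<open>y\<close> or beyond, with carry -1.\<close>

lemma spherical_curvature_pos:
  assumes "r \<ge> 1" "coord g = (x, y, k * y - s)" "int r < m" "m \<le> x" "x < 2 * m"
    "8 * (int r * m) \<le> y" "3 * m \<le> k" "k < 4 * m" "y - m \<le> s" "s < y"
  shows "spherical_curvature Heis heis_gens r g > 0"
proof -
  define e :: "int \<Rightarrow> int" where "e q = - of_bool (q < 0)" for q
  define N where "N = int r * m"
  have N: "m \<le> N" "8 * N \<le> y" using assms(1,3,6) by (simp_all add: N_def)
  have pos: "int (heis_length g) = 2 * k + y - x"
    using assms(2) by (rule heis_length_eq) (use assms N in linarith)+
  have eq: "spherical_curvature Heis heis_gens r g =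
    - real_of_int (2 * (\<Sum>w\<in>heis_sphere r. e (coord_y w))) /
      (real (card (heis_sphere r)) * real (heis_length g))"
  proof (rule spherical_curvature_eq)
    fix w assume w: "w \<in> heis_sphere r"
    have shift: "\<bar>x * coord_y w\<bar> \<le> 2 * N"
      using shift_bound[OF w] assms by (simp add: N_def)
    have "0 \<le> s - x * coord_y w + e (coord_y w) * y \<and> s - x * coord_y w + e (coord_y w) * y < y"
    proof (cases "coord_y w < 0")
      case True
      have "x * coord_y w \<le> - x" "e (coord_y w) = - 1"
        using True assms mult_left_mono[of "coord_y w" "- 1" x] by (simp_all add: e_def)
      then show ?thesis
        using shift assms(4,9,10) N by simp
    next
      case False
      have "0 \<le> x * coord_y w" "e (coord_y w) = 0"
        using False assms by (simp_all add: e_def)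
      then have "0 \<le> s - x * coord_y w" "s - x * coord_y w < y"
        using shift assms(9,10) N by linarith+
      then show ?thesis
        using \<open>e (coord_y w) = 0\<close> by simp
    qed
    then show "int (heis_length (inv\<^bsub>Heis\<^esub> w \<otimes>\<^bsub>Heis\<^esub> g \<otimes>\<^bsub>Heis\<^esub> w)) =
        int (heis_length g) + 2 * (e (coord_y w) - coord_x w)"
      using heis_length_conjugate[OF assms(2) w assms(3) _ assms(5,7,8), of "e (coord_y w)"] assms N
      by (simp add: e_def)
  qed
  have "(0::int) < (\<Sum>w\<in>heis_sphere r. of_bool (coord_y w < 0))"
  proof (rule sum_of_bool_pos[OF finite_heis_sphere])
    show "inv\<^bsub>Heis\<^esub> heis_prod (replicate r heis_b) \<in> heis_sphere r"
      using b_pow_mem_heis_sphere[of r] by (simp add: mem_heis_sphere)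
    show "coord_y (inv\<^bsub>Heis\<^esub> heis_prod (replicate r heis_b)) < 0"
      using assms(1) by (simp add: coord_xy_inv coord_y_b_pow del: foldr_replicate)
  qed
  then have "(\<Sum>w\<in>heis_sphere r. e (coord_y w)) < 0"
    unfolding e_def sum_negf by simp
  moreover have "0 < card (heis_sphere r)"
    using b_pow_mem_heis_sphere finite_heis_sphere by (auto simp: card_gt_0_iff)
  moreover have "0 < heis_length g"
    using pos assms N by linarith
  ultimately show ?thesis
    unfolding eq by (intro divide_pos_pos mult_pos_pos) (simp_all del: of_int_sum)
qed

section \<open>Density\<close>

text \<open>The function \<open>\<sigma>\<close> selects a window of \<open>m\<close> remainders,
  parametrized by \<open>t\<close>. With \<open>m\<close> proportional to \<open>n\<close>, the free
  choice of \<open>x\<close>, \<open>y\<close>, \<open>k\<close>, \<open>t\<close> from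
  \<open>m\<close> values each gives \<open>m^4\<close> elements of \<open>P\<close> in the
  ball.\<close>

lemma positive_density_if_region:
  fixes \<sigma> :: "int \<Rightarrow> int \<Rightarrow> int \<Rightarrow> int"
  assumes r: "r \<ge> 1"
    and \<sigma>_range: "\<And>m y t. 0 \<le> t \<Longrightarrow> t < m \<Longrightarrow> 8 * (int r * m) \<le> y \<Longrightarrow> 0 \<le> \<sigma> m y t \<and> \<sigma> m y t < y"
    and \<sigma>_inj: "\<And>m y t t'. \<sigma> m y t = \<sigma> m y t' \<Longrightarrow> t = t'"
    and mem: "\<And>g m x y k t. \<lbrakk>coord g = (x, y, k * y - \<sigma> m y t); int r < m; m \<le> x; x < 2 * m;
        8 * (int r * m) \<le> y; 3 * m \<le> k; k < 4 * m; 0 \<le> t; t < m\<rbrakk> \<Longrightarrow> g \<in> P"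
  shows "positive_density Heis heis_gens P"
proof -
  \<comment> \<open>The ball has at most \<open>27 * n^4\<close> elements, and
    \<open>n <= 34 * r * m\<close> for the scale \<open>m\<close> chosen below.\<close>
  define c :: real where "c = 1 / (27 * (34 * real r) ^ 4)"
  have "c \<le> real (card (P \<inter> word_ball Heis heis_gens n)) / real (card (word_ball Heis heis_gens n))"
    if n: "n \<ge> 17 * r * (r + 1)" for n
  proof -
    \<comment> \<open>Lengths in the region stay below
      \<open>8 * m + 8 * r * m <= 16 * r * m\<close>, so this scale keeps the region inside the
      ball.\<close>
    define m where "m = n div (17 * r)"
    let ?m = "int m"
    let ?Y = "8 * (int r * ?m)"
    let ?I = "{?m..<2 * ?m} \<times> {?Y..<?Y + ?m} \<times> {3 * ?m..<4 * ?m} \<times> {0..<?m}"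
    let ?F = "\<lambda>(x, y, k, t). (x, y, k * y - \<sigma> ?m y t)"
    \<comment> \<open>The threshold on \<open>n\<close> is chosen to give \<open>r < m\<close>, as
      the regimes require.\<close>
    have "r + 1 \<le> m"
      using n r unfolding m_def by (simp add: less_eq_div_iff_mult_less_eq algebra_simps)
    then have "int r < ?m" by simp
    have "17 * (r * m) \<le> n"
      unfolding m_def using div_times_less_eq_dividend[of n "17 * r"] by (simp add: algebra_simps)
    then have n_ge: "17 * (int r * ?m) \<le> int n"
      using of_nat_mono[of "17 * (r * m)" n, where 'a = int] by simp
    have rm: "?m \<le> int r * ?m" using r mult_right_mono[of 1 "int r" ?m] by simp
    have inj: "inj_on ?F ?I"
    proof (rule inj_onI)
      fix i j assume ij: "i \<in> ?I" "j \<in> ?I" "?F i = ?F j"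
      obtain x y k t where i: "i = (x, y, k, t)" by (cases i)
      obtain x' y' k' t' where j: "j = (x', y', k', t')" by (cases j)
      have eq: "x' = x" "y' = y" "k * y - \<sigma> ?m y t = k' * y - \<sigma> ?m y t'"
        using ij(3) unfolding i j by auto
      have s: "0 \<le> \<sigma> ?m y t" "\<sigma> ?m y t < y" "0 \<le> \<sigma> ?m y t'" "\<sigma> ?m y t' < y"
        using \<sigma>_range ij(1,2) unfolding i j eq by auto
      \<comment> \<open>Both remainders lie between 0 and \<open>y - 1\<close>, so their difference
        is a multiple of \<open>y\<close> only if it is 0: the quotient \<open>k\<close> is
        determined by the third coordinate.\<close>
      have "(k - k') * y = \<sigma> ?m y t - \<sigma> ?m y t'"
        using eq(3) unfolding left_diff_distrib by linarith
      then have "\<bar>(k - k') * y\<bar> < 1 * y"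
        using s by linarith
      moreover have "\<bar>y\<bar> = y" "0 < y"
        using s by linarith+
      ultimately have "\<bar>k - k'\<bar> < 1"
        by (simp only: abs_mult mult_less_cancel_right_pos)
      then have "k = k'" by simp
      with eq \<sigma>_inj show "i = j" unfolding i j by auto
    qed
    have "?F ` ?I \<subseteq> coord ` (P \<inter> word_ball Heis heis_gens n)"
    proof
      fix a assume "a \<in> ?F ` ?I"
      then obtain x y k t where a: "a = (x, y, k * y - \<sigma> ?m y t)"
        and b: "?m \<le> x" "x < 2 * ?m" "?Y \<le> y" "y < ?Y + ?m" "3 * ?m \<le> k" "k < 4 * ?m"
          "0 \<le> t" "t < ?m"
        by auto
      have s: "0 \<le> \<sigma> ?m y t" "\<sigma> ?m y t < y"
        using \<sigma>_range b by auto
      obtain g where g: "coord g = (x, y, k * y - \<sigma> ?m y t)"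
        "int (heis_length g) \<le> 2 * k + y - x"
        by (rule heis_elt_exists[of x k "\<sigma> ?m y t" y]) (use b s in linarith)+
      have "g \<in> P"
        using mem[OF g(1)] b \<open>int r < ?m\<close> by simp
      moreover have "int (heis_length g) \<le> int n"
        using g(2) b n_ge rm by linarith
      ultimately show "a \<in> coord ` (P \<inter> word_ball Heis heis_gens n)"
        using g(1) a by (intro image_eqI[of _ _ g]) (simp_all add: word_ball_def)
    qed
    then have "card (?F ` ?I) \<le> card (P \<inter> word_ball Heis heis_gens n)"
      by (rule surj_card_le[rotated]) (simp add: finite_word_ball)
    moreover have "card (?F ` ?I) = m ^ 4"
    proof -
      have "card ?I = m * (m * (m * m))"
        unfolding card_cartesian_product by simp
      then show ?thesis
        using card_image[OF inj] by (simp add: power4_eq_xxxx mult.assoc)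
    qed
    ultimately have P: "real m ^ 4 \<le> real (card (P \<inter> word_ball Heis heis_gens n))"
      using of_nat_mono[of "m ^ 4", where 'a = real] by simp
    have "1 \<le> r * (r + 1)" using r by simp
    then have "1 \<le> n" using n by linarith
    have "n < 17 * r * (m + 1)"
      using dividend_less_times_div[of "17 * r" n] r unfolding m_def by simp
    \<comment> \<open>As \<open>m >= 1\<close>, rounding in the division costs at most a factor
      2.\<close>
    also have "\<dots> \<le> 17 * r * (2 * m)"
      using \<open>r + 1 \<le> m\<close> by (intro mult_left_mono) simp_all
    finally have "n \<le> 34 * r * m" by simp
    then have "real n \<le> 34 * real r * real m"
      using of_nat_mono[of n "34 * r * m", where 'a = real] by simp
    then have "real n ^ 4 \<le> (34 * real r * real m) ^ 4"
      by (rule power_mono) simp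
    then have n4: "real n ^ 4 \<le> (34 * real r) ^ 4 * real m ^ 4"
      by (simp only: power_mult_distrib)
    have "card (word_ball Heis heis_gens n) \<le> (3 * n) * ((3 * n) * (3 * n\<^sup>2))"
      using \<open>1 \<le> n\<close> by (intro order.trans[OF card_word_ball_le] mult_mono) simp_all
    then have "real (card (word_ball Heis heis_gens n)) \<le> real ((3 * n) * ((3 * n) * (3 * n\<^sup>2)))"
      by (rule of_nat_mono)
    also have "\<dots> = 27 * real n ^ 4"
      by (simp add: power4_eq_xxxx power2_eq_square)
    also have "\<dots> \<le> 27 * ((34 * real r) ^ 4 * real m ^ 4)"
      by (rule mult_left_mono[OF n4]) simp
    also have "\<dots> \<le> 27 * ((34 * real r) ^ 4 * real (card (P \<inter> word_ball Heis heis_gens n)))"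
      using P by (intro mult_left_mono) simp_all
    finally have "c * real (card (word_ball Heis heis_gens n)) \<le>
        real (card (P \<inter> word_ball Heis heis_gens n))"
      using r unfolding c_def by (simp add: field_simps)
    moreover have "0 < card (word_ball Heis heis_gens n)"
    proof -
      have "\<one>\<^bsub>Heis\<^esub> \<in> word_ball Heis heis_gens n"
        using heis_length_le[of "[]"] by (simp add: word_ball_def)
      then show ?thesis
        using finite_word_ball by (auto simp: card_gt_0_iff)
    qed
    ultimately show ?thesis
      by (simp add: pos_le_divide_eq)
  qed
  then have "ereal c \<le> liminf (\<lambda>n. ereal (real (card (P \<inter> word_ball Heis heis_gens n)) /
      real (card (word_ball Heis heis_gens n))))"
    by (intro Liminf_bounded) (auto intro: eventually_sequentiallyI)
  moreover have "0 < ereal c"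
    using r by (simp add: c_def)
  ultimately show ?thesis
    unfolding positive_density_def by (rule less_le_trans[rotated])
qed

theorem theorem4p1:
  fixes r :: nat
  assumes "r \<ge> 1"
  shows "positive_density Heis heis_gens
           {g \<in> carrier Heis. g \<noteq> \<one>\<^bsub>Heis\<^esub> \<and> spherical_curvature Heis heis_gens r g > 0}
       \<and> positive_density Heis heis_gens
           {g \<in> carrier Heis. g \<noteq> \<one>\<^bsub>Heis\<^esub> \<and> spherical_curvature Heis heis_gens r g = 0}
       \<and> positive_density Heis heis_gens
           {g \<in> carrier Heis. g \<noteq> \<one>\<^bsub>Heis\<^esub> \<and> spherical_curvature Heis heis_gens r g < 0}"
proof -
  have rm: "m \<le> int r * m" if "0 < m" for m
    using that assms by simp
  \<comment> \<open>The windows for positive, zero and negative curvature: downwards from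
    \<open>y - 1\<close>, upwards from \<open>2 * (int r * m)\<close>, and upwards from 0.\<close>
  have range: "0 \<le> y - 1 - t \<and> y - 1 - t < y" "0 \<le> 2 * (int r * m) + t \<and> 2 * (int r * m) + t < y"
    "0 \<le> t \<and> t < y" if "0 \<le> t" "t < m" "8 * (int r * m) \<le> y" for m y t :: int
    using that rm[of m] by linarith+
  have ne: "g \<noteq> \<one>\<^bsub>Heis\<^esub>" if "coord g = (x, y, z)" "int r < m" "m \<le> x" for g m x y z
    using that by auto
  have "positive_density Heis heis_gens
      {g \<in> carrier Heis. g \<noteq> \<one>\<^bsub>Heis\<^esub> \<and> spherical_curvature Heis heis_gens r g > 0}"
  proof (rule positive_density_if_region[OF assms range(1)])
    fix g m x y k t
    assume a: "coord g = (x, y, k * y - (y - 1 - t))" "int r < m" "m \<le> x" "x < 2 * m"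
      "8 * (int r * m) \<le> y" "3 * m \<le> k" "k < 4 * m" "0 \<le> t" "t < m"
    have "spherical_curvature Heis heis_gens r g > 0"
      by (rule spherical_curvature_pos[OF assms a(1-7)]) (use a in linarith)+
    then show "g \<in> {g \<in> carrier Heis. g \<noteq> \<one>\<^bsub>Heis\<^esub> \<and> spherical_curvature Heis heis_gens r g > 0}"
      using ne[OF a(1-3)] by simp
  qed auto
  moreover have "positive_density Heis heis_gens
      {g \<in> carrier Heis. g \<noteq> \<one>\<^bsub>Heis\<^esub> \<and> spherical_curvature Heis heis_gens r g = 0}"
  proof (rule positive_density_if_region[OF assms range(2)])
    fix g m x y k t
    assume a: "coord g = (x, y, k * y - (2 * (int r * m) + t))" "int r < m" "m \<le> x" "x < 2 * m"
      "8 * (int r * m) \<le> y" "3 * m \<le> k" "k < 4 * m" "0 \<le> t" "t < m"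
    have "spherical_curvature Heis heis_gens r g = 0"
      by (rule spherical_curvature_zero[OF assms a(1-7)]) (use a rm[of m] in linarith)+
    then show "g \<in> {g \<in> carrier Heis. g \<noteq> \<one>\<^bsub>Heis\<^esub> \<and> spherical_curvature Heis heis_gens r g = 0}"
      using ne[OF a(1-3)] by simp
  qed auto
  moreover have "positive_density Heis heis_gens
      {g \<in> carrier Heis. g \<noteq> \<one>\<^bsub>Heis\<^esub> \<and> spherical_curvature Heis heis_gens r g < 0}"
  proof (rule positive_density_if_region[OF assms range(3)])
    fix g m x y k t
    assume a: "coord g = (x, y, k * y - t)" "int r < m" "m \<le> x" "x < 2 * m"
      "8 * (int r * m) \<le> y" "3 * m \<le> k" "k < 4 * m" "0 \<le> t" "t < m"
    have "spherical_curvature Heis heis_gens r g < 0"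
      by (rule spherical_curvature_neg[OF assms a])
    then show "g \<in> {g \<in> carrier Heis. g \<noteq> \<one>\<^bsub>Heis\<^esub> \<and> spherical_curvature Heis heis_gens r g < 0}"
      using ne[OF a(1-3)] by simp
  qed auto
  ultimately show ?thesis by blast
qed

end
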